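(* Let $\Sigma$ be a finite alphabet. For every $\mathsf{K}_{\mathrm{t}}[\#]$ formula $\phi$ over $\Sigma$ there is a $\mathsf{C}\text{-}\mathsf{RASP}$ program $P$ over $\Sigma$ such that for every nonempty string $w\in\Sigma^*$, $w$ end-satisfies $\phi$ if and only if $P$ accepts $w$; and conversely, for every $\mathsf{C}\text{-}\mathsf{RASP}$ program $P$ over $\Sigma$ there is a $\mathsf{K}_{\mathrm{t}}[\#]$ formula $\phi$ over $\Sigma$ such that for every nonempty $w\in\Sigma^*$, $w$ end-satisfies $\phi$ if and only if $P$ accepts $w$. In particular, a language is recognized by a $\mathsf{C}\text{-}\mathsf{RASP}$ program if and only if it is defined by a $\mathsf{K}_{\mathrm{t}}[\#]$ formula.
   Context: Strings are $w=w_1w_2\cdots w_n$ with $n\ge 1$ over a finite alphabet $\Sigma$. The logic $\mathsf{K}_{\mathrm{t}}[\#]$: formulas $F ::= Q_a \mid \lnot F \mid F\land F \mid C\le C \mid \top$ (for $a\in\Sigma$), and count terms $C ::= \#[F] \mid C+C \mid C-C \mid 1$. They are interpreted at a position $i\in[1,n]$ of $w$: $\#[F]^{w,i}=|\{j\in[1,i] : w,j\vDash F\}|$, $(C_1\pm C_2)^{w,i}=C_1^{w,i}\pm C_2^{w,i}$, $1^{w,i}=1$; $w,i\vDash Q_a$ iff $w_i=a$; $\lnot$ and $\land$ are as usual; $w,i\vDash C_1\le C_2$ iff $C_1^{w,i}\le C_2^{w,i}$; $w,i\vDash\top$ always. A string $w$ of length $n$ end-satisfies $\phi$ iff $w,n\vDash\phi$;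 the language defined by $\phi$ is the set of (nonempty) strings that end-satisfy $\phi$. A $\mathsf{C}\text{-}\mathsf{RASP}$ program over $\Sigma$ is a finite sequence of operations, each defining either a Boolean-valued sequence $P(i)$ or an integer-valued sequence $C(i)$ over positions $i\in[1,n]$ of the input $w$, in terms of earlier operations. Boolean-valued operations: $P(i):=Q_a(i)$ for $a\in\Sigma$ (true iff $w_i=a$); $P(i):=\lnot P_1(i)$; $P(i):=P_1(i)\land P_2(i)$; $P(i):=C_1(i)\le C_2(i)$; $P(i):=1$ (always true). Count-valued operations: $C(i):=\#[j\le i]\,P(j)$ (the number of $j\in[1,i]$ with $P(j)$ true); $C(i):=P(i)\,?\,C_1(i):C_2(i)$ (equal to $C_1(i)$ if $P(i)$ is true and to $C_2(i)$ otherwise); $C(i):=C_1(i)+C_2(i)$; $C(i):=C_1(i)-C_2(i)$; $C(i):=\min(C_1(i),C_2(i))$; $C(i):=\max(C_1(i),C_2(i))$; $C(i):=1$. The last operation of the program must be Boolean-valued, and the program accepts an input $w$ of length $n$ iff its last operation is true at position $n$. *)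

theory Defs
  imports Main
begin

text \<open>
  The alphabet is an arbitrary finite set \<open>\<Sigma> :: 'a set\<close>; a \<open>K\<^sub>t[#]\<close> formula is over \<open>\<Sigma>\<close> if all its letters lie
  in \<open>\<Sigma>\<close>. The functions \<open>kt_letters\<close> and \<open>kt_term_letters\<close> (and \<open>op_letters\<close> below) are the set
  functions generated by the datatype package.
\<close>

datatype (kt_letters: 'a) kt_formula =
    KLetter 'a
  | KNot "'a kt_formula"
  | KAnd "'a kt_formula" "'a kt_formula"
  | KLe "'a kt_term" "'a kt_term"
  | KTrue
and (kt_term_letters: 'a) kt_term =
    KCount "'a kt_formula"
  | KPlus "'a kt_term" "'a kt_term"
  | KMinus "'a kt_term" "'a kt_term"
  | KOne

text \<open>
  Positions are numbered from 1, so position \<open>i\<close> of \<open>w\<close> carries the letter \<open>w ! (i - 1)\<close>.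
  Only positions \<open>i \<in> {1..length w}\<close> are meaningful.
\<close>

primrec kt_sat :: "'a kt_formula \<Rightarrow> 'a list \<Rightarrow> nat \<Rightarrow> bool"
  and kt_val :: "'a kt_term \<Rightarrow> 'a list \<Rightarrow> nat \<Rightarrow> int" where
  "kt_sat (KLetter a) w i \<longleftrightarrow> w ! (i - 1) = a"
| "kt_sat (KNot F) w i \<longleftrightarrow> \<not> kt_sat F w i"
| "kt_sat (KAnd F G) w i \<longleftrightarrow> kt_sat F w i \<and> kt_sat G w i"
| "kt_sat (KLe C D) w i \<longleftrightarrow> kt_val C w i \<le> kt_val D w i"
| "kt_sat KTrue w i \<longleftrightarrow> True"
| "kt_val (KCount F) w i = int (card {j \<in> {1..i}. kt_sat F w j})"
| "kt_val (KPlus C D) w i = kt_val C w i + kt_val D w i"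
| "kt_val (KMinus C D) w i = kt_val C w i - kt_val D w i"
| "kt_val KOne w i = 1"

definition end_satisfies :: "'a list \<Rightarrow> 'a kt_formula \<Rightarrow> bool" where
  "end_satisfies w \<phi> \<longleftrightarrow> kt_sat \<phi> w (length w)"

definition kt_over :: "'a set \<Rightarrow> 'a kt_formula \<Rightarrow> bool" where
  "kt_over \<Sigma> \<phi> \<longleftrightarrow> kt_letters \<phi> \<subseteq> \<Sigma>"

definition kt_language :: "'a set \<Rightarrow> 'a kt_formula \<Rightarrow> 'a list set" where
  "kt_language \<Sigma> \<phi> = {w \<in> lists \<Sigma>. w \<noteq> [] \<and> end_satisfies w \<phi>}"

text \<open>
  A C-RASP program is a list of operations. An argument of type \<open>nat\<close> is the (0-based) index in that list of
  the operation it refers to.  In \<open>CCond p c d\<close>, \<open>p\<close> is the condition.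
\<close>

datatype (op_letters: 'a) crasp_op =
    BLetter 'a
  | BNot nat
  | BAnd nat nat
  | BLe nat nat
  | BTrue
  | CCount nat
  | CCond nat nat nat
  | CAdd nat nat
  | CSub nat nat
  | CMin nat nat
  | CMax nat nat
  | COne

type_synonym 'a crasp = "'a crasp_op list"

fun is_bool_op :: "'a crasp_op \<Rightarrow> bool" where
  "is_bool_op (BLetter a) = True"
| "is_bool_op (BNot p) = True"
| "is_bool_op (BAnd p q) = True"
| "is_bool_op (BLe c d) = True"
| "is_bool_op BTrue = True"
| "is_bool_op _ = False"

text \<open>The indices that an operation uses as Boolean-valued and as count-valued, respectively.\<close>

fun bool_args :: "'a crasp_op \<Rightarrow> nat set" where
  "bool_args (BNot p) = {p}"
| "bool_args (BAnd p q) = {p, q}"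
| "bool_args (CCount p) = {p}"
| "bool_args (CCond p c d) = {p}"
| "bool_args _ = {}"

fun count_args :: "'a crasp_op \<Rightarrow> nat set" where
  "count_args (BLe c d) = {c, d}"
| "count_args (CCond p c d) = {c, d}"
| "count_args (CAdd c d) = {c, d}"
| "count_args (CSub c d) = {c, d}"
| "count_args (CMin c d) = {c, d}"
| "count_args (CMax c d) = {c, d}"
| "count_args _ = {}"

definition crasp_over :: "'a set \<Rightarrow> 'a crasp \<Rightarrow> bool" where
  "crasp_over \<Sigma> P \<longleftrightarrow>
     P \<noteq> [] \<and> is_bool_op (last P) \<and>
     (\<forall>x \<in> set P. op_letters x \<subseteq> \<Sigma>) \<and>
     (\<forall>k < length P.
        (\<forall>r \<in> bool_args (P ! k). r < k \<and> is_bool_op (P ! r)) \<and>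
        (\<forall>r \<in> count_args (P ! k). r < k \<and> \<not> is_bool_op (P ! r)))"

datatype crasp_val = BoolSeq (bool_seq: "nat \<Rightarrow> bool") | CountSeq (count_seq: "nat \<Rightarrow> int")

text \<open>
  The sequence defined by an operation on input \<open>w\<close>, where \<open>vs\<close> lists the sequences defined by the
  earlier operations. For programs satisfying \<^const>\<open>crasp_over\<close>, every lookup is in range and
  every selector is applied to a value of the matching kind.
\<close>

primrec op_val :: "'a list \<Rightarrow> crasp_val list \<Rightarrow> 'a crasp_op \<Rightarrow> crasp_val" where
  "op_val w vs (BLetter a) = BoolSeq (\<lambda>i. w ! (i - 1) = a)"
| "op_val w vs (BNot p) = BoolSeq (\<lambda>i. \<not> bool_seq (vs ! p) i)"
| "op_val w vs (BAnd p q) = BoolSeq (\<lambda>i. bool_seq (vs ! p) i \<and> bool_seq (vs ! q) i)"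
| "op_val w vs (BLe c d) = BoolSeq (\<lambda>i. count_seq (vs ! c) i \<le> count_seq (vs ! d) i)"
| "op_val w vs BTrue = BoolSeq (\<lambda>i. True)"
| "op_val w vs (CCount p) = CountSeq (\<lambda>i. int (card {j \<in> {1..i}. bool_seq (vs ! p) j}))"
| "op_val w vs (CCond p c d) =
     CountSeq (\<lambda>i. if bool_seq (vs ! p) i then count_seq (vs ! c) i else count_seq (vs ! d) i)"
| "op_val w vs (CAdd c d) = CountSeq (\<lambda>i. count_seq (vs ! c) i + count_seq (vs ! d) i)"
| "op_val w vs (CSub c d) = CountSeq (\<lambda>i. count_seq (vs ! c) i - count_seq (vs ! d) i)"
| "op_val w vs (CMin c d) = CountSeq (\<lambda>i. min (count_seq (vs ! c) i) (count_seq (vs ! d) i))"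
| "op_val w vs (CMax c d) = CountSeq (\<lambda>i. max (count_seq (vs ! c) i) (count_seq (vs ! d) i))"
| "op_val w vs COne = CountSeq (\<lambda>i. 1)"

definition crasp_run :: "'a list \<Rightarrow> 'a crasp \<Rightarrow> crasp_val list" where
  "crasp_run w P = foldl (\<lambda>vs x. vs @ [op_val w vs x]) [] P"

definition crasp_accepts :: "'a crasp \<Rightarrow> 'a list \<Rightarrow> bool" where
  "crasp_accepts P w \<longleftrightarrow> bool_seq (last (crasp_run w P)) (length w)"

definition crasp_language :: "'a set \<Rightarrow> 'a crasp \<Rightarrow> 'a list set" where
  "crasp_language \<Sigma> P = {w \<in> lists \<Sigma>. w \<noteq> [] \<and> crasp_accepts P w}"

lemma crasp_run_Nil [simp]: "crasp_run w [] = []"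
  by (simp add: crasp_run_def)

lemma crasp_run_snoc [simp]:
  "crasp_run w (P @ [x]) = crasp_run w P @ [op_val w (crasp_run w P) x]"
  by (simp add: crasp_run_def)

lemma length_crasp_run [simp]: "length (crasp_run w P) = length P"
  by (induction P rule: rev_induct) simp_all

lemma crasp_run_nth:
  "k < length P \<Longrightarrow> crasp_run w P ! k = op_val w (take k (crasp_run w P)) (P ! k)"
  by (induction P rule: rev_induct) (auto simp: nth_append less_Suc_eq)

end

(*
  The only C-RASP operations without an immediate counterpart among count terms are the conditional,
  min and max.  A count-valued operation is therefore represented by a finite case distinction: a
  finite set of pairs (guard, term) whose guards cover all positions and whose terms have the value
  of the operation wherever their guard holds.  Such case distinctions are closed under sums,
  differences and conditionals, and the comparison of two of them is a finite disjunction, hence a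
  formula; min and max are conditionals on a comparison.  Conversely, a formula is compiled bottom-up,
  one operation per subformula occurrence.
*)

theory Submission
  imports Defs
begin

section \<open>From formulas to programs\<close>

text \<open>The local conditions of \<open>crasp_over\<close> alone: nonemptiness and a Boolean last
  operation are dropped, so that the empty program and every intermediate stage of a compilation
  qualify.\<close>

definition crasp_wf :: "'a set \<Rightarrow> 'a crasp \<Rightarrow> bool" where
  "crasp_wf \<Sigma> P \<longleftrightarrow>
     (\<forall>x \<in> set P. op_letters x \<subseteq> \<Sigma>) \<and>
     (\<forall>k < length P.
        (\<forall>r \<in> bool_args (P ! k). r < k \<and> is_bool_op (P ! r)) \<and>
        (\<forall>r \<in> count_args (P ! k). r < k \<and> \<not> is_bool_op (P ! r)))"

text \<open>One index has to serve all inputs \<open>w\<close>. The syntactic kind of the operation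
  is recorded as well, because well-formedness of later operations that refer to \<open>k\<close>
  depends on it.\<close>

definition bool_at :: "'a crasp \<Rightarrow> nat \<Rightarrow> ('a list \<Rightarrow> nat \<Rightarrow> bool) \<Rightarrow> bool" where
  "bool_at P k b \<longleftrightarrow> k < length P \<and> is_bool_op (P ! k) \<and> (\<forall>w. crasp_run w P ! k = BoolSeq (b w))"

definition count_at :: "'a crasp \<Rightarrow> nat \<Rightarrow> ('a list \<Rightarrow> nat \<Rightarrow> int) \<Rightarrow> bool" where
  "count_at P k c \<longleftrightarrow> k < length P \<and> \<not> is_bool_op (P ! k) \<and> (\<forall>w. crasp_run w P ! k = CountSeq (c w))"

lemma last_crasp_run: "P \<noteq> [] \<Longrightarrow> last (crasp_run w P) = crasp_run w P ! (length P - 1)"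
  by (cases P rule: rev_cases) (simp_all add: nth_append)

text \<open>A run only ever appends values, so sequences already computed survive any extension of
  the program. Hence an index obtained early in a compilation remains usable later.\<close>

lemma crasp_run_append_nth:
  "k < length P \<Longrightarrow> crasp_run w (P @ Q) ! k = crasp_run w P ! k"
  by (induction Q rule: rev_induct) (simp_all add: nth_append flip: append_assoc)

lemma bool_at_append: "bool_at P k b \<Longrightarrow> bool_at (P @ Q) k b"
  by (auto simp: bool_at_def crasp_run_append_nth nth_append)

lemma count_at_append: "count_at P k c \<Longrightarrow> count_at (P @ Q) k c"
  by (auto simp: count_at_def crasp_run_append_nth nth_append)

lemma crasp_wf_snoc:
  assumes "crasp_wf \<Sigma> P" "op_letters x \<subseteq> \<Sigma>"
    and "\<forall>r \<in> bool_args x. r < length P \<and> is_bool_op (P ! r)"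
    and "\<forall>r \<in> count_args x. r < length P \<and> \<not> is_bool_op (P ! r)"
  shows "crasp_wf \<Sigma> (P @ [x])"
  unfolding crasp_wf_def
proof (intro conjI allI impI)
  show "\<forall>y \<in> set (P @ [x]). op_letters y \<subseteq> \<Sigma>"
    using assms(1,2) by (auto simp: crasp_wf_def)
next
  fix k assume k: "k < length (P @ [x])"
  \<comment> \<open>Old operations refer only to indices below \<open>k\<close>, where
    \<open>P\<close> and \<open>P @ [x]\<close> carry the same operations. The new operation at
    index \<open>length P\<close> is covered by the assumptions on \<open>x\<close>.\<close>
  have old: "(\<forall>r \<in> bool_args (P ! k). r < k \<and> is_bool_op (P ! r)) \<and>
      (\<forall>r \<in> count_args (P ! k). r < k \<and> \<not> is_bool_op (P ! r))" if "k < length P"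
    using assms(1) that by (simp add: crasp_wf_def)
  show "\<forall>r \<in> bool_args ((P @ [x]) ! k). r < k \<and> is_bool_op ((P @ [x]) ! r)"
    using assms(3) k old by (cases "k = length P") (fastforce simp: nth_append)+
  show "\<forall>r \<in> count_args ((P @ [x]) ! k). r < k \<and> \<not> is_bool_op ((P @ [x]) ! r)"
    using assms(4) k old by (cases "k = length P") (fastforce simp: nth_append)+
qed

lemma bool_at_snoc:
  "is_bool_op x \<Longrightarrow> (\<And>w. op_val w (crasp_run w P) x = BoolSeq (b w)) \<Longrightarrow>
    bool_at (P @ [x]) (length P) b"
  by (auto simp: bool_at_def nth_append)

lemma count_at_snoc:
  "\<not> is_bool_op x \<Longrightarrow> (\<And>w. op_val w (crasp_run w P) x = CountSeq (c w)) \<Longrightarrow>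
    count_at (P @ [x]) (length P) c"
  by (auto simp: count_at_def nth_append)

section \<open>Compilation by appending operations\<close>

text \<open>Quantifying over all well-formed start programs \<open>P\<close> lets pieces be compiled
  on top of each other without renumbering references. The condition
  \<open>Suc k = length (P @ Q)\<close> places the result in the last operation, which is the one
  that acceptance reads; the count version below leaves the index free.\<close>

definition bool_compilable :: "'a set \<Rightarrow> ('a list \<Rightarrow> nat \<Rightarrow> bool) \<Rightarrow> bool" where
  "bool_compilable \<Sigma> b \<longleftrightarrow> (\<forall>P. crasp_wf \<Sigma> P \<longrightarrow>
     (\<exists>Q k. crasp_wf \<Sigma> (P @ Q) \<and> bool_at (P @ Q) k b \<and> Suc k = length (P @ Q)))"

definition count_compilable :: "'a set \<Rightarrow> ('a list \<Rightarrow> nat \<Rightarrow> int) \<Rightarrow> bool" where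
  "count_compilable \<Sigma> c \<longleftrightarrow> (\<forall>P. crasp_wf \<Sigma> P \<longrightarrow>
     (\<exists>Q k. crasp_wf \<Sigma> (P @ Q) \<and> count_at (P @ Q) k c))"

text \<open>It is enough to prepare the arguments by some \<open>Q\<close> and then append a single
  operation computing \<open>b\<close> from them.\<close>

lemma bool_compilableI:
  assumes "\<And>P. crasp_wf \<Sigma> P \<Longrightarrow>
    \<exists>Q x. crasp_wf \<Sigma> (P @ Q @ [x]) \<and> is_bool_op x \<and>
      (\<forall>w. op_val w (crasp_run w (P @ Q)) x = BoolSeq (b w))"
  shows "bool_compilable \<Sigma> b"
  unfolding bool_compilable_def
proof (intro allI impI)
  fix P assume "crasp_wf \<Sigma> P"
  then obtain Q x where "crasp_wf \<Sigma> (P @ Q @ [x])" "is_bool_op x"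
    "\<And>w. op_val w (crasp_run w (P @ Q)) x = BoolSeq (b w)"
    using assms by blast
  \<comment> \<open>Since indices are 0-based, the operation appended after \<open>P @ Q\<close> has
    index \<open>length (P @ Q)\<close>.\<close>
  then show "\<exists>Q k. crasp_wf \<Sigma> (P @ Q) \<and> bool_at (P @ Q) k b \<and> Suc k = length (P @ Q)"
    using bool_at_snoc[of x "P @ Q" b]
    by (intro exI[of _ "Q @ [x]"] exI[of _ "length (P @ Q)"]) simp
qed

lemma count_compilableI:
  assumes "\<And>P. crasp_wf \<Sigma> P \<Longrightarrow>
    \<exists>Q x. crasp_wf \<Sigma> (P @ Q @ [x]) \<and> \<not> is_bool_op x \<and>
      (\<forall>w. op_val w (crasp_run w (P @ Q)) x = CountSeq (c w))"
  shows "count_compilable \<Sigma> c"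
  unfolding count_compilable_def
proof (intro allI impI)
  fix P assume "crasp_wf \<Sigma> P"
  then obtain Q x where "crasp_wf \<Sigma> (P @ Q @ [x])" "\<not> is_bool_op x"
    "\<And>w. op_val w (crasp_run w (P @ Q)) x = CountSeq (c w)"
    using assms by blast
  then show "\<exists>Q k. crasp_wf \<Sigma> (P @ Q) \<and> count_at (P @ Q) k c"
    using count_at_snoc[of x "P @ Q" c]
    by (intro exI[of _ "Q @ [x]"] exI[of _ "length (P @ Q)"]) simp
qed

lemma bool_compilable_op0:
  assumes "op_letters x \<subseteq> \<Sigma>" "is_bool_op x" "bool_args x = {}" "count_args x = {}"
    and "\<And>w vs. op_val w vs x = BoolSeq (b w)"
  shows "bool_compilable \<Sigma> b"
  using assms by (intro bool_compilableI exI[of _ "[]"] exI[of _ x]) (simp add: crasp_wf_snoc)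

lemma bool_compilable_not:
  assumes "bool_compilable \<Sigma> b"
  shows "bool_compilable \<Sigma> (\<lambda>w i. \<not> b w i)"
proof (rule bool_compilableI)
  fix P assume "crasp_wf \<Sigma> P"
  then obtain Q k where Q: "crasp_wf \<Sigma> (P @ Q)" "bool_at (P @ Q) k b"
    using assms unfolding bool_compilable_def by blast
  then show "\<exists>Q x. crasp_wf \<Sigma> (P @ Q @ [x]) \<and> is_bool_op x \<and>
      (\<forall>w. op_val w (crasp_run w (P @ Q)) x = BoolSeq (\<lambda>i. \<not> b w i))"
    using crasp_wf_snoc[OF Q(1), of "BNot k"]
    by (intro exI[of _ Q] exI[of _ "BNot k"]) (simp add: bool_at_def)
qed

lemma count_compilable_count:
  assumes "bool_compilable \<Sigma> b"
  shows "count_compilable \<Sigma> (\<lambda>w i. int (card {j \<in> {1..i}. b w j}))"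
proof (rule count_compilableI)
  fix P assume "crasp_wf \<Sigma> P"
  then obtain Q k where Q: "crasp_wf \<Sigma> (P @ Q)" "bool_at (P @ Q) k b"
    using assms unfolding bool_compilable_def by blast
  then show "\<exists>Q x. crasp_wf \<Sigma> (P @ Q @ [x]) \<and> \<not> is_bool_op x \<and>
      (\<forall>w. op_val w (crasp_run w (P @ Q)) x = CountSeq (\<lambda>i. int (card {j \<in> {1..i}. b w j})))"
    using crasp_wf_snoc[OF Q(1), of "CCount k"]
    by (intro exI[of _ Q] exI[of _ "CCount k"]) (simp add: bool_at_def)
qed

lemma bool_compilable_and:
  assumes "bool_compilable \<Sigma> a" "bool_compilable \<Sigma> b"
  shows "bool_compilable \<Sigma> (\<lambda>w i. a w i \<and> b w i)"
proof (rule bool_compilableI)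
  fix P assume "crasp_wf \<Sigma> P"
  then obtain Q k where Q: "crasp_wf \<Sigma> (P @ Q)" "bool_at (P @ Q) k a"
    using assms(1) unfolding bool_compilable_def by blast
  \<comment> \<open>The second conjunct is compiled with \<open>P @ Q\<close> as its start program.
    Its code comes after that of the first, so index \<open>k\<close> still denotes \<open>a\<close>
    and a final \<open>BAnd k l\<close> can refer to both.\<close>
  then obtain R l where R: "crasp_wf \<Sigma> ((P @ Q) @ R)" "bool_at ((P @ Q) @ R) l b"
    using assms(2) unfolding bool_compilable_def by blast
  show "\<exists>Q x. crasp_wf \<Sigma> (P @ Q @ [x]) \<and> is_bool_op x \<and>
      (\<forall>w. op_val w (crasp_run w (P @ Q)) x = BoolSeq (\<lambda>i. a w i \<and> b w i))"
    using crasp_wf_snoc[OF R(1), of "BAnd k l"] R(2) bool_at_append[OF Q(2), of R]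
    by (intro exI[of _ "Q @ R"] exI[of _ "BAnd k l"]) (simp add: bool_at_def)
qed

text \<open>Sequential compilation of two counts into one program, shared by comparison, sum and
  difference.\<close>

lemma count_compilable_pair:
  assumes "count_compilable \<Sigma> c" "count_compilable \<Sigma> d" "crasp_wf \<Sigma> P"
  obtains Q k l where "crasp_wf \<Sigma> (P @ Q)" "count_at (P @ Q) k c" "count_at (P @ Q) l d"
proof -
  obtain Q k where Q: "crasp_wf \<Sigma> (P @ Q)" "count_at (P @ Q) k c"
    using assms(1,3) unfolding count_compilable_def by blast
  then obtain R l where R: "crasp_wf \<Sigma> ((P @ Q) @ R)" "count_at ((P @ Q) @ R) l d"
    using assms(2) unfolding count_compilable_def by blast
  show thesis
    using that[of "Q @ R" k l] R count_at_append[OF Q(2), of R] by simp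
qed

lemma bool_compilable_le:
  assumes "count_compilable \<Sigma> c" "count_compilable \<Sigma> d"
  shows "bool_compilable \<Sigma> (\<lambda>w i. c w i \<le> d w i)"
proof (rule bool_compilableI)
  fix P assume "crasp_wf \<Sigma> P"
  then obtain Q k l where Q: "crasp_wf \<Sigma> (P @ Q)" "count_at (P @ Q) k c" "count_at (P @ Q) l d"
    by (rule count_compilable_pair[OF assms])
  then show "\<exists>Q x. crasp_wf \<Sigma> (P @ Q @ [x]) \<and> is_bool_op x \<and>
      (\<forall>w. op_val w (crasp_run w (P @ Q)) x = BoolSeq (\<lambda>i. c w i \<le> d w i))"
    using crasp_wf_snoc[OF Q(1), of "BLe k l"]
    by (intro exI[of _ Q] exI[of _ "BLe k l"]) (simp add: count_at_def)
qed

lemma count_compilable_add: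
  assumes "count_compilable \<Sigma> c" "count_compilable \<Sigma> d"
  shows "count_compilable \<Sigma> (\<lambda>w i. c w i + d w i)"
proof (rule count_compilableI)
  fix P assume "crasp_wf \<Sigma> P"
  then obtain Q k l where Q: "crasp_wf \<Sigma> (P @ Q)" "count_at (P @ Q) k c" "count_at (P @ Q) l d"
    by (rule count_compilable_pair[OF assms])
  then show "\<exists>Q x. crasp_wf \<Sigma> (P @ Q @ [x]) \<and> \<not> is_bool_op x \<and>
      (\<forall>w. op_val w (crasp_run w (P @ Q)) x = CountSeq (\<lambda>i. c w i + d w i))"
    using crasp_wf_snoc[OF Q(1), of "CAdd k l"]
    by (intro exI[of _ Q] exI[of _ "CAdd k l"]) (simp add: count_at_def)
qed

lemma count_compilable_diff:
  assumes "count_compilable \<Sigma> c" "count_compilable \<Sigma> d"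
  shows "count_compilable \<Sigma> (\<lambda>w i. c w i - d w i)"
proof (rule count_compilableI)
  fix P assume "crasp_wf \<Sigma> P"
  then obtain Q k l where Q: "crasp_wf \<Sigma> (P @ Q)" "count_at (P @ Q) k c" "count_at (P @ Q) l d"
    by (rule count_compilable_pair[OF assms])
  then show "\<exists>Q x. crasp_wf \<Sigma> (P @ Q @ [x]) \<and> \<not> is_bool_op x \<and>
      (\<forall>w. op_val w (crasp_run w (P @ Q)) x = CountSeq (\<lambda>i. c w i - d w i))"
    using crasp_wf_snoc[OF Q(1), of "CSub k l"]
    by (intro exI[of _ Q] exI[of _ "CSub k l"]) (simp add: count_at_def)
qed

lemma count_compilable_one: "count_compilable \<Sigma> (\<lambda>w i. 1)"
  by (intro count_compilableI exI[of _ "[]"] exI[of _ COne]) (simp add: crasp_wf_snoc)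

text \<open>Simultaneous induction, with one closure property per constructor. Those properties
  speak of functions of \<open>w\<close> and \<open>i\<close>, so the semantic clauses are first
  turned into equations between functions by extensionality.\<close>

lemma kt_compilable:
  "kt_letters \<phi> \<subseteq> \<Sigma> \<Longrightarrow> bool_compilable \<Sigma> (kt_sat \<phi>)"
  "kt_term_letters t \<subseteq> \<Sigma> \<Longrightarrow> count_compilable \<Sigma> (kt_val t)"
proof (induction \<phi> and t)
  case (KLetter a)
  then show ?case
    by (intro bool_compilable_op0[of "BLetter a"]) (simp_all add: fun_eq_iff)
next
  case (KNot F)
  then have "bool_compilable \<Sigma> (\<lambda>w i. \<not> kt_sat F w i)"
    by (intro bool_compilable_not) simp
  moreover have "kt_sat (KNot F) = (\<lambda>w i. \<not> kt_sat F w i)"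
    by (intro ext) simp
  ultimately show ?case
    by simp
next
  case (KAnd F G)
  then have "bool_compilable \<Sigma> (\<lambda>w i. kt_sat F w i \<and> kt_sat G w i)"
    by (intro bool_compilable_and) simp_all
  moreover have "kt_sat (KAnd F G) = (\<lambda>w i. kt_sat F w i \<and> kt_sat G w i)"
    by (intro ext) simp
  ultimately show ?case
    by simp
next
  case (KLe C D)
  then have "bool_compilable \<Sigma> (\<lambda>w i. kt_val C w i \<le> kt_val D w i)"
    by (intro bool_compilable_le) simp_all
  moreover have "kt_sat (KLe C D) = (\<lambda>w i. kt_val C w i \<le> kt_val D w i)"
    by (intro ext) simp
  ultimately show ?case
    by simp
next
  case KTrue
  then show ?case
    by (intro bool_compilable_op0[of BTrue]) (simp_all add: fun_eq_iff)
next
  case (KCount F)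
  then have "count_compilable \<Sigma> (\<lambda>w i. int (card {j \<in> {1..i}. kt_sat F w j}))"
    by (intro count_compilable_count) simp
  moreover have "kt_val (KCount F) = (\<lambda>w i. int (card {j \<in> {1..i}. kt_sat F w j}))"
    by (intro ext) simp
  ultimately show ?case
    by simp
next
  case (KPlus C D)
  then have "count_compilable \<Sigma> (\<lambda>w i. kt_val C w i + kt_val D w i)"
    by (intro count_compilable_add) simp_all
  moreover have "kt_val (KPlus C D) = (\<lambda>w i. kt_val C w i + kt_val D w i)"
    by (intro ext) simp
  ultimately show ?case
    by simp
next
  case (KMinus C D)
  then have "count_compilable \<Sigma> (\<lambda>w i. kt_val C w i - kt_val D w i)"
    by (intro count_compilable_diff) simp_all
  moreover have "kt_val (KMinus C D) = (\<lambda>w i. kt_val C w i - kt_val D w i)"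
    by (intro ext) simp
  ultimately show ?case
    by simp
next
  case KOne
  have "kt_val KOne = (\<lambda>(w :: 'a list) i. 1)"
    by (intro ext) simp
  then show ?case
    using count_compilable_one by simp
qed

lemma crasp_of_kt:
  assumes "kt_over \<Sigma> \<phi>"
  shows "\<exists>P. crasp_over \<Sigma> P \<and> (\<forall>w. end_satisfies w \<phi> \<longleftrightarrow> crasp_accepts P w)"
proof -
  have "bool_compilable \<Sigma> (kt_sat \<phi>)"
    using assms kt_compilable(1) by (simp add: kt_over_def)
  \<comment> \<open>Starting the compilation from the empty program makes the appended operations
    the whole program.\<close>
  moreover have "crasp_wf \<Sigma> ([] :: 'a crasp)"
    by (simp add: crasp_wf_def)
  ultimately obtain P k where P: "crasp_wf \<Sigma> P" "bool_at P k (kt_sat \<phi>)" "Suc k = length P"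
    unfolding bool_compilable_def by (metis append_Nil)
  \<comment> \<open>The equation \<open>Suc k = length P\<close> identifies \<open>k\<close> as the
    index of the last operation, so the value at \<open>k\<close> decides acceptance.\<close>
  have "P \<noteq> []" and k: "k = length P - 1"
    using P(3) by auto
  then have "last P = P ! k" "\<And>w. last (crasp_run w P) = crasp_run w P ! k"
    by (simp_all add: last_conv_nth last_crasp_run)
  then show ?thesis
    using P(1,2) \<open>P \<noteq> []\<close>
    by (intro exI[of _ P])
      (simp add: bool_at_def crasp_wf_def crasp_over_def crasp_accepts_def end_satisfies_def)
qed

section \<open>From programs to formulas\<close>

text \<open>Agreement is demanded at every position and not just at the end of the word, because
  counting evaluates the formula at all earlier positions.\<close>

definition bool_definable :: "'a set \<Rightarrow> ('a list \<Rightarrow> nat \<Rightarrow> bool) \<Rightarrow> bool" where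
  "bool_definable \<Sigma> b \<longleftrightarrow> (\<exists>F. kt_over \<Sigma> F \<and> (\<forall>w i. kt_sat F w i \<longleftrightarrow> b w i))"

text \<open>Pairs consist of a guard and a term. Guards may overlap: all terms whose guards hold at
  a position have the value of \<open>c\<close> there, hence agree. Finiteness is what later allows
  a choice of case to be written as one disjunction.\<close>

definition case_split :: "'a set \<Rightarrow> ('a kt_formula \<times> 'a kt_term) set \<Rightarrow> ('a list \<Rightarrow> nat \<Rightarrow> int) \<Rightarrow> bool"
  where
  "case_split \<Sigma> S c \<longleftrightarrow> finite S \<and>
     (\<forall>(F, C) \<in> S. kt_letters F \<subseteq> \<Sigma> \<and> kt_term_letters C \<subseteq> \<Sigma>) \<and>
     (\<forall>w i. (\<exists>(F, C) \<in> S. kt_sat F w i) \<and> (\<forall>(F, C) \<in> S. kt_sat F w i \<longrightarrow> kt_val C w i = c w i))"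

definition count_definable :: "'a set \<Rightarrow> ('a list \<Rightarrow> nat \<Rightarrow> int) \<Rightarrow> bool" where
  "count_definable \<Sigma> c \<longleftrightarrow> (\<exists>S. case_split \<Sigma> S c)"

lemma case_splitI:
  assumes "finite S"
    and "\<And>F C. (F, C) \<in> S \<Longrightarrow> kt_letters F \<subseteq> \<Sigma> \<and> kt_term_letters C \<subseteq> \<Sigma>"
    and "\<And>w i. \<exists>F C. (F, C) \<in> S \<and> kt_sat F w i"
    and "\<And>F C w i. (F, C) \<in> S \<Longrightarrow> kt_sat F w i \<Longrightarrow> kt_val C w i = c w i"
  shows "case_split \<Sigma> S c"
  using assms unfolding case_split_def by blast

lemma case_splitD:
  assumes "case_split \<Sigma> S c" "(F, C) \<in> S"
  shows "kt_letters F \<subseteq> \<Sigma>" "kt_term_letters C \<subseteq> \<Sigma>" "kt_sat F w i \<Longrightarrow> kt_val C w i = c w i"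
  using assms unfolding case_split_def by blast+

lemma case_splitE:
  assumes "case_split \<Sigma> S c"
  obtains F C where "(F, C) \<in> S" "kt_sat F w i" "kt_val C w i = c w i"
  using assms unfolding case_split_def by blast

section \<open>Boolean combinations and comparisons\<close>

lemma bool_definable_letter: "a \<in> \<Sigma> \<Longrightarrow> bool_definable \<Sigma> (\<lambda>w i. w ! (i - 1) = a)"
  unfolding bool_definable_def by (rule exI[of _ "KLetter a"]) (simp add: kt_over_def)

lemma bool_definable_not: "bool_definable \<Sigma> b \<Longrightarrow> bool_definable \<Sigma> (\<lambda>w i. \<not> b w i)"
  unfolding bool_definable_def kt_over_def by (metis kt_formula.set(2) kt_sat.simps(2))

lemma bool_definable_and:
  assumes "bool_definable \<Sigma> a" "bool_definable \<Sigma> b"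
  shows "bool_definable \<Sigma> (\<lambda>w i. a w i \<and> b w i)"
proof -
  obtain F G where "kt_over \<Sigma> F" "\<And>w i. kt_sat F w i \<longleftrightarrow> a w i"
    "kt_over \<Sigma> G" "\<And>w i. kt_sat G w i \<longleftrightarrow> b w i"
    using assms unfolding bool_definable_def by blast
  then show ?thesis
    unfolding bool_definable_def by (intro exI[of _ "KAnd F G"]) (simp add: kt_over_def)
qed

lemma bool_definable_true: "bool_definable \<Sigma> (\<lambda>w i. True)"
  unfolding bool_definable_def by (rule exI[of _ KTrue]) (simp add: kt_over_def)

text \<open>Induction on the finite index set. Formulas offer only negation and conjunction, so each
  disjunction is expressed by De Morgan, and the empty one as the negation of truth.\<close>

lemma bool_definable_Bex:
  assumes "finite S" "\<And>s. s \<in> S \<Longrightarrow> bool_definable \<Sigma> (b s)"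
  shows "bool_definable \<Sigma> (\<lambda>w i. \<exists>s \<in> S. b s w i)"
  using assms
proof (induction S rule: finite_induct)
  case empty
  show ?case
    using bool_definable_not[OF bool_definable_true] by simp
next
  case (insert s S)
  have "bool_definable \<Sigma> (\<lambda>w i. \<not> (\<not> b s w i \<and> \<not> (\<exists>s \<in> S. b s w i)))"
    by (intro bool_definable_not bool_definable_and insert.IH insert.prems) auto
  then show ?case
    by simp
qed

text \<open>The comparison holds iff for some pair of cases both guards are true and the two terms
  satisfy the inequality; this is a disjunction over the finite set \<open>S \<times> T\<close>. The
  case distinctions thereby disappear into a single formula.\<close>

lemma bool_definable_le:
  assumes "count_definable \<Sigma> c" "count_definable \<Sigma> d"
  shows "bool_definable \<Sigma> (\<lambda>w i. c w i \<le> d w i)"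
proof -
  obtain S T where S: "case_split \<Sigma> S c" and T: "case_split \<Sigma> T d"
    using assms unfolding count_definable_def by blast
  let ?b = "\<lambda>((F, C), (G, D)). kt_sat (KAnd (KAnd F G) (KLe C D))"
  have "bool_definable \<Sigma> (?b s)" if "s \<in> S \<times> T" for s
  proof -
    obtain F C G D where s: "s = ((F, C), (G, D))"
      by (metis surj_pair)
    then have "(F, C) \<in> S" "(G, D) \<in> T"
      using that by auto
    then have "kt_over \<Sigma> (KAnd (KAnd F G) (KLe C D))"
      using case_splitD(1,2)[OF S] case_splitD(1,2)[OF T] by (simp add: kt_over_def)
    then show ?thesis
      unfolding bool_definable_def s by (intro exI[of _ "KAnd (KAnd F G) (KLe C D)"]) simp
  qed
  moreover have "finite (S \<times> T)"
    using S T by (simp add: case_split_def)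
  ultimately have "bool_definable \<Sigma> (\<lambda>w i. \<exists>s \<in> S \<times> T. ?b s w i)"
    by (intro bool_definable_Bex)
  moreover have "(\<exists>s \<in> S \<times> T. ?b s w i) \<longleftrightarrow> c w i \<le> d w i" for w i
  proof
    \<comment> \<open>Whichever pair witnesses the disjunction, its true guards force the terms to
      have the values of \<open>c\<close> and \<open>d\<close>.\<close>
    assume "\<exists>s \<in> S \<times> T. ?b s w i"
    then show "c w i \<le> d w i"
      using case_splitD(3)[OF S] case_splitD(3)[OF T] by fastforce
  next
    assume le: "c w i \<le> d w i"
    \<comment> \<open>Conversely, the guards of each case distinction cover every position, which
      supplies a case on either side.\<close>
    obtain F C where F: "(F, C) \<in> S" "kt_sat F w i" "kt_val C w i = c w i"
      using case_splitE[OF S] .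
    obtain G D where G: "(G, D) \<in> T" "kt_sat G w i" "kt_val D w i = d w i"
      using case_splitE[OF T] .
    show "\<exists>s \<in> S \<times> T. ?b s w i"
      using F G le by (intro bexI[of _ "((F, C), (G, D))"]) simp_all
  qed
  ultimately show ?thesis
    by simp
qed

section \<open>Closure properties of counts given by cases\<close>

lemma count_definable_term:
  assumes "kt_term_letters C \<subseteq> \<Sigma>"
  shows "count_definable \<Sigma> (kt_val C)"
  using assms unfolding count_definable_def case_split_def
  by (intro exI[of _ "{(KTrue, C)}"]) simp

text \<open>Counting is applied to a Boolean sequence, which is defined by one formula
  \<open>F\<close> at all positions; so the single term \<open>KCount F\<close> suffices and no case
  distinction arises.\<close>

lemma count_definable_count:
  assumes "bool_definable \<Sigma> b"
  shows "count_definable \<Sigma> (\<lambda>w i. int (card {j \<in> {1..i}. b w j}))"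
proof -
  obtain F where F: "kt_over \<Sigma> F" "\<And>w i. kt_sat F w i \<longleftrightarrow> b w i"
    using assms unfolding bool_definable_def by blast
  have "count_definable \<Sigma> (kt_val (KCount F))"
    using F(1) by (intro count_definable_term) (simp add: kt_over_def)
  moreover have "kt_val (KCount F) = (\<lambda>w i. int (card {j \<in> {1..i}. b w j}))"
    by (intro ext) (simp add: F(2))
  ultimately show ?thesis
    by simp
qed

lemma count_definable_one: "count_definable \<Sigma> (\<lambda>(w :: 'a list) i. 1)"
proof -
  have "kt_val KOne = (\<lambda>(w :: 'a list) i. 1)"
    by (intro ext) simp
  then show ?thesis
    using count_definable_term[of "KOne :: 'a kt_term" \<Sigma>] by simp
qed

text \<open>The common refinement of the two case distinctions: conjoin the guards and combine the
  terms. \<open>K\<close> is a term constructor and \<open>f\<close> its interpretation, so that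
  sums and differences are handled at once.\<close>

lemma count_definable_binop:
  fixes \<Sigma> :: "'a set" and K :: "'a kt_term \<Rightarrow> 'a kt_term \<Rightarrow> 'a kt_term"
  assumes "count_definable \<Sigma> c" "count_definable \<Sigma> d"
    and letters: "\<And>C D. kt_term_letters (K C D) = kt_term_letters C \<union> kt_term_letters D"
    and val: "\<And>C D w i. kt_val (K C D) w i = f (kt_val C w i) (kt_val D w i)"
  shows "count_definable \<Sigma> (\<lambda>w i. f (c w i) (d w i))"
proof -
  obtain S T where S: "case_split \<Sigma> S c" and T: "case_split \<Sigma> T d"
    using assms(1,2) unfolding count_definable_def by blast
  let ?U = "(\<lambda>((F, C), (G, D)). (KAnd F G, K C D)) ` (S \<times> T)"
  have U: "\<exists>F C G D. (F, C) \<in> S \<and> (G, D) \<in> T \<and> H = KAnd F G \<and> E = K C D"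
    if "(H, E) \<in> ?U" for H E
    using that by auto
  have "case_split \<Sigma> ?U (\<lambda>w i. f (c w i) (d w i))"
  proof (rule case_splitI)
    show "finite ?U"
      using S T by (simp add: case_split_def)
  next
    fix H E assume "(H, E) \<in> ?U"
    then obtain F C G D where "(F, C) \<in> S" "(G, D) \<in> T" and HE: "H = KAnd F G" "E = K C D"
      using U by blast
    with case_splitD[OF S] case_splitD[OF T]
    show "kt_letters H \<subseteq> \<Sigma> \<and> kt_term_letters E \<subseteq> \<Sigma>"
      and "kt_sat H w i \<Longrightarrow> kt_val E w i = f (c w i) (d w i)" for w i
      by (simp_all add: letters val)
  next
    fix w i
    obtain F C where F: "(F, C) \<in> S" "kt_sat F w i"
      using case_splitE[OF S] .
    obtain G D where G: "(G, D) \<in> T" "kt_sat G w i"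
      using case_splitE[OF T] .
    have "(KAnd F G, K C D) \<in> ?U"
      using F(1) G(1) by (intro image_eqI[of _ _ "((F, C), (G, D))"]) simp_all
    moreover have "kt_sat (KAnd F G) w i"
      using F(2) G(2) by simp
    ultimately show "\<exists>H E. (H, E) \<in> ?U \<and> kt_sat H w i"
      by blast
  qed
  then show ?thesis
    unfolding count_definable_def by blast
qed

text \<open>The guards for \<open>c\<close> are strengthened by the condition and those for
  \<open>d\<close> by its negation. The union of both families still covers every position, and only
  cases of the selected branch can apply.\<close>

lemma count_definable_if:
  assumes "bool_definable \<Sigma> b" "count_definable \<Sigma> c" "count_definable \<Sigma> d"
  shows "count_definable \<Sigma> (\<lambda>w i. if b w i then c w i else d w i)"
proof -
  obtain B where B: "kt_letters B \<subseteq> \<Sigma>" "\<And>w i. kt_sat B w i \<longleftrightarrow> b w i"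
    using assms(1) unfolding bool_definable_def kt_over_def by blast
  obtain S T where S: "case_split \<Sigma> S c" and T: "case_split \<Sigma> T d"
    using assms(2,3) unfolding count_definable_def by blast
  let ?U = "(\<lambda>(F, C). (KAnd B F, C)) ` S \<union> (\<lambda>(F, C). (KAnd (KNot B) F, C)) ` T"
  have "case_split \<Sigma> ?U (\<lambda>w i. if b w i then c w i else d w i)"
  proof (rule case_splitI)
    show "finite ?U"
      using S T by (simp add: case_split_def)
  next
    fix H E assume "(H, E) \<in> ?U"
    then consider F where "(F, E) \<in> S" "H = KAnd B F" | F where "(F, E) \<in> T" "H = KAnd (KNot B) F"
      by auto
    note cases = this
    show "kt_letters H \<subseteq> \<Sigma> \<and> kt_term_letters E \<subseteq> \<Sigma>"
      by (rule cases) (use B(1) case_splitD(1,2)[OF S] case_splitD(1,2)[OF T] in auto)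
    show "kt_val E w i = (if b w i then c w i else d w i)" if "kt_sat H w i" for w i
      by (rule cases) (use that B(2) case_splitD(3)[OF S] case_splitD(3)[OF T] in auto)
  next
    fix w i
    show "\<exists>H E. (H, E) \<in> ?U \<and> kt_sat H w i"
    proof (cases "b w i")
      case True
      obtain F C where F: "(F, C) \<in> S" "kt_sat F w i"
        using case_splitE[OF S] .
      have "(KAnd B F, C) \<in> ?U"
        using F(1) by force
      moreover have "kt_sat (KAnd B F) w i"
        using F(2) True B(2) by simp
      ultimately show ?thesis
        by blast
    next
      case False
      obtain F C where F: "(F, C) \<in> T" "kt_sat F w i"
        using case_splitE[OF T] .
      have "(KAnd (KNot B) F, C) \<in> ?U"
        using F(1) by force
      moreover have "kt_sat (KAnd (KNot B) F) w i"
        using F(2) False B(2) by simp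
      ultimately show ?thesis
        by blast
    qed
  qed
  then show ?thesis
    unfolding count_definable_def by blast
qed

lemma count_definable_min:
  "count_definable \<Sigma> c \<Longrightarrow> count_definable \<Sigma> d \<Longrightarrow> count_definable \<Sigma> (\<lambda>w i. min (c w i) (d w i))"
  unfolding min_def by (intro count_definable_if bool_definable_le)

lemma count_definable_max:
  "count_definable \<Sigma> c \<Longrightarrow> count_definable \<Sigma> d \<Longrightarrow> count_definable \<Sigma> (\<lambda>w i. max (c w i) (d w i))"
  unfolding max_def by (intro count_definable_if bool_definable_le)

section \<open>Induction along a program\<close>

text \<open>Strong induction on the index: arguments refer to strictly earlier operations of the
  required kind. That kind also decides which selector of \<open>crasp_val\<close> is meaningful,
  hence the two implications.\<close>

lemma crasp_op_definable:
  assumes "crasp_over \<Sigma> P" "k < length P"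
  shows "(is_bool_op (P ! k) \<longrightarrow> bool_definable \<Sigma> (\<lambda>w. bool_seq (crasp_run w P ! k))) \<and>
    (\<not> is_bool_op (P ! k) \<longrightarrow> count_definable \<Sigma> (\<lambda>w. count_seq (crasp_run w P ! k)))"
  using assms(2)
proof (induction k rule: less_induct)
  case (less k)
  have args: "\<forall>r \<in> bool_args (P ! k). r < k \<and> is_bool_op (P ! r)"
    "\<forall>r \<in> count_args (P ! k). r < k \<and> \<not> is_bool_op (P ! r)"
    and letters: "op_letters (P ! k) \<subseteq> \<Sigma>"
    using assms(1) less.prems by (auto simp: crasp_over_def)
  have B: "bool_definable \<Sigma> (\<lambda>w. bool_seq (crasp_run w P ! r))" if "r \<in> bool_args (P ! k)" for r
    using that args less by auto
  have C: "count_definable \<Sigma> (\<lambda>w. count_seq (crasp_run w P ! r))" if "r \<in> count_args (P ! k)" for r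
    using that args less by auto
  \<comment> \<open>This rule expresses the value through \<open>take k\<close> of the run.
    Arguments lie below \<open>k\<close> by \<open>args\<close>, so lookups in the prefix are
    lookups in the whole run, to which \<open>B\<close> and \<open>C\<close> apply.\<close>
  note run = crasp_run_nth[OF less.prems]
  show ?case
  proof (cases "P ! k")
    case (BLetter a)
    then show ?thesis
      using letters bool_definable_letter[of a \<Sigma>] by (simp add: run)
  next
    case (BNot p)
    then show ?thesis
      using args B[of p] by (simp add: run bool_definable_not)
  next
    case (BAnd p q)
    then show ?thesis
      using args B[of p] B[of q] by (simp add: run bool_definable_and)
  next
    case (BLe c d)
    then show ?thesis
      using args C[of c] C[of d] by (simp add: run bool_definable_le)
  next
    case BTrue
    then show ?thesis
      using bool_definable_true by (simp add: run)
  next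
    case (CCount p)
    then show ?thesis
      using args B[of p] count_definable_count[of \<Sigma> "\<lambda>w. bool_seq (crasp_run w P ! p)"]
      by (simp add: run)
  next
    case (CCond p c d)
    then show ?thesis
      using args B[of p] C[of c] C[of d] by (simp add: run count_definable_if)
  next
    case (CAdd c d)
    then show ?thesis
      using args C[of c] C[of d]
      by (simp add: run count_definable_binop[where K = KPlus and f = "(+)"])
  next
    case (CSub c d)
    then show ?thesis
      using args C[of c] C[of d]
      by (simp add: run count_definable_binop[where K = KMinus and f = "(-)"])
  next
    case (CMin c d)
    then show ?thesis
      using args C[of c] C[of d] by (simp add: run count_definable_min)
  next
    case (CMax c d)
    then show ?thesis
      using args C[of c] C[of d] by (simp add: run count_definable_max)
  next
    case COne
    then show ?thesis
      using count_definable_one by (simp add: run)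
  qed
qed

text \<open>The formula defining the last operation works: acceptance and end-satisfaction both
  evaluate at position \<open>length w\<close>.\<close>

lemma kt_of_crasp:
  assumes "crasp_over \<Sigma> P"
  shows "\<exists>\<phi>. kt_over \<Sigma> \<phi> \<and> (\<forall>w. end_satisfies w \<phi> \<longleftrightarrow> crasp_accepts P w)"
proof -
  let ?k = "length P - 1"
  have "P \<noteq> []" "is_bool_op (P ! ?k)"
    using assms by (auto simp: crasp_over_def last_conv_nth)
  moreover have "last (crasp_run w P) = crasp_run w P ! ?k" for w
    using \<open>P \<noteq> []\<close> by (rule last_crasp_run)
  moreover have "?k < length P"
    using \<open>P \<noteq> []\<close> by simp
  ultimately have "bool_definable \<Sigma> (\<lambda>w. bool_seq (last (crasp_run w P)))"
    using crasp_op_definable[OF assms, of ?k] by simp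
  then show ?thesis
    unfolding bool_definable_def end_satisfies_def crasp_accepts_def by blast
qed

section \<open>Equality of the two classes of languages\<close>

theorem theorem1:
  fixes \<Sigma> :: "'a set"
  assumes "finite \<Sigma>"
  shows "(\<forall>\<phi>. kt_over \<Sigma> \<phi> \<longrightarrow>
            (\<exists>P. crasp_over \<Sigma> P \<and>
               (\<forall>w \<in> lists \<Sigma>. w \<noteq> [] \<longrightarrow> (end_satisfies w \<phi> \<longleftrightarrow> crasp_accepts P w)))) \<and>
         (\<forall>P. crasp_over \<Sigma> P \<longrightarrow>
            (\<exists>\<phi>. kt_over \<Sigma> \<phi> \<and>
               (\<forall>w \<in> lists \<Sigma>. w \<noteq> [] \<longrightarrow> (end_satisfies w \<phi> \<longleftrightarrow> crasp_accepts P w)))) \<and>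
         (\<forall>L :: 'a list set.
            (\<exists>P. crasp_over \<Sigma> P \<and> L = crasp_language \<Sigma> P) \<longleftrightarrow>
            (\<exists>\<phi>. kt_over \<Sigma> \<phi> \<and> L = kt_language \<Sigma> \<phi>))"
proof (intro conjI allI impI)
  fix \<phi> :: "'a kt_formula" assume "kt_over \<Sigma> \<phi>"
  then show "\<exists>P. crasp_over \<Sigma> P \<and>
      (\<forall>w \<in> lists \<Sigma>. w \<noteq> [] \<longrightarrow> (end_satisfies w \<phi> \<longleftrightarrow> crasp_accepts P w))"
    using crasp_of_kt by blast
next
  fix P :: "'a crasp" assume "crasp_over \<Sigma> P"
  then show "\<exists>\<phi>. kt_over \<Sigma> \<phi> \<and>
      (\<forall>w \<in> lists \<Sigma>. w \<noteq> [] \<longrightarrow> (end_satisfies w \<phi> \<longleftrightarrow> crasp_accepts P w))"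
    using kt_of_crasp by blast
next
  fix L :: "'a list set"
  \<comment> \<open>Both languages are cut out of the nonempty words over \<open>\<Sigma>\<close> by
    an acceptance condition, so equivalent conditions give equal languages.\<close>
  show "(\<exists>P. crasp_over \<Sigma> P \<and> L = crasp_language \<Sigma> P) \<longleftrightarrow>
      (\<exists>\<phi>. kt_over \<Sigma> \<phi> \<and> L = kt_language \<Sigma> \<phi>)"
  proof
    assume "\<exists>P. crasp_over \<Sigma> P \<and> L = crasp_language \<Sigma> P"
    then obtain P where P: "crasp_over \<Sigma> P" "L = crasp_language \<Sigma> P"
      by blast
    obtain \<phi> where "kt_over \<Sigma> \<phi>" "\<forall>w. end_satisfies w \<phi> \<longleftrightarrow> crasp_accepts P w"
      using kt_of_crasp[OF P(1)] by blast
    then show "\<exists>\<phi>. kt_over \<Sigma> \<phi> \<and> L = kt_language \<Sigma> \<phi>"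
      using P(2) by (intro exI[of _ \<phi>]) (simp add: crasp_language_def kt_language_def)
  next
    assume "\<exists>\<phi>. kt_over \<Sigma> \<phi> \<and> L = kt_language \<Sigma> \<phi>"
    then obtain \<phi> where \<phi>: "kt_over \<Sigma> \<phi>" "L = kt_language \<Sigma> \<phi>"
      by blast
    obtain P where "crasp_over \<Sigma> P" "\<forall>w. end_satisfies w \<phi> \<longleftrightarrow> crasp_accepts P w"
      using crasp_of_kt[OF \<phi>(1)] by blast
    then show "\<exists>P. crasp_over \<Sigma> P \<and> L = crasp_language \<Sigma> P"
      using \<phi>(2) by (intro exI[of _ P]) (simp add: crasp_language_def kt_language_def)
  qed
qed

end
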